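(* Let $g_1, \dots, g_m \in \mathbb{R}[x]$, $x=(x_1,\dots,x_n)$, be such that $S=\{x\in \mathbb{R}^n: g_1(x)\ge 0,\dots,g_m(x) \ge 0\}$ is a non-empty compact set. Let $L \in \mathbb{R}^n$ and $M\in \mathbb{R}$ be such that $S \subseteq \{x \in \mathbb{R}^n: L \le x,\ e^\top x \le M\}$. Let $\hat M \ge M+\sum_{j=1}^m \|g_j\| \,(1+M + e^\top(|L|-L))^{\deg g_j}$ and define $$\hat{g}(x) := \left(x-L,\ g(x),\ \hat M- e^\top x - e^\top g(x) \right) \in \mathbb{R}[x]^{n+m+1},$$ where $g(x)=(g_1(x),\dots,g_m(x))$. If $p\in\mathbb{R}[x]$ satisfies $p(x)>0$ for all $x\in S$, then there exist $n$-variate SOS polynomials $\sigma_{0}$ and $\sigma_1$, and univariate SOS polynomials $\rho_1,\dots,\rho_{n+m+1}$ such that $$p(x) = \sigma_0(x)+\sigma_1(x)\Big( \hat M^2-\sum_{i=1}^{n+m+1} \hat{g}_i(x)^2\Big) +\sum_{i=1}^{n+m+1} \rho_i(\hat{g}_i(x))\,\hat{g}_i(x).$$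
   Context: $e$ is the all-ones vector of appropriate dimension; $|L|$ is the componentwise absolute value; vector inequalities are componentwise. A polynomial is SOS if it is a finite sum of squares of real polynomials. Norm of a polynomial: for $q\in\mathbb{R}[x]$ with $d=\deg q$, write $q(x)=\sum_{\alpha\in\mathbb{N}^n,\ \sum_i\alpha_i\le d}\binom{d}{\alpha}q_\alpha x^\alpha$ with $\binom{d}{\alpha}=\frac{d!}{(d-\sum_i\alpha_i)!\,\alpha_1!\cdots\alpha_n!}$; then $\|q\|=\max_\alpha|q_\alpha|$. *)

theory Defs
  imports
    "HOL-Analysis.Analysis"
    "HOL-Computational_Algebra.Polynomial"
    "HOL-Library.Poly_Mapping"
begin

text \<open>
  Real polynomials in the variables \<open>x $ i\<close>, \<open>i :: 'n\<close>, are finitely supported maps from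
  exponent vectors to coefficients; their ring operations are those of \<^theory>\<open>HOL-Library.Poly_Mapping\<close>.
\<close>

type_synonym 'n mpoly = "('n \<Rightarrow>\<^sub>0 nat) \<Rightarrow>\<^sub>0 real"

definition Const :: "real \<Rightarrow> 'n::finite mpoly" where
  "Const c = Poly_Mapping.single 0 c"

definition Var :: "'n::finite \<Rightarrow> 'n mpoly" where
  "Var i = Poly_Mapping.single (Poly_Mapping.single i 1) 1"

definition meval :: "'n::finite mpoly \<Rightarrow> real ^ 'n \<Rightarrow> real" where
  "meval p x = (\<Sum>\<alpha>\<in>Poly_Mapping.keys p.
     Poly_Mapping.lookup p \<alpha> * (\<Prod>i\<in>UNIV. (x $ i) ^ Poly_Mapping.lookup \<alpha> i))"

definition exp_sum :: "('n::finite \<Rightarrow>\<^sub>0 nat) \<Rightarrow> nat" where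
  "exp_sum \<alpha> = (\<Sum>i\<in>UNIV. Poly_Mapping.lookup \<alpha> i)"

text \<open>The zero polynomial gets degree 0.\<close>

definition tdeg :: "'n::finite mpoly \<Rightarrow> nat" where
  "tdeg p = Max (insert 0 (exp_sum ` Poly_Mapping.keys p))"

definition multinom :: "nat \<Rightarrow> ('n::finite \<Rightarrow>\<^sub>0 nat) \<Rightarrow> real" where
  "multinom d \<alpha> =
     fact d / (fact (d - exp_sum \<alpha>) * (\<Prod>i\<in>UNIV. fact (Poly_Mapping.lookup \<alpha> i)))"

definition mnorm :: "'n::finite mpoly \<Rightarrow> real" where
  "mnorm q = Max ((\<lambda>\<alpha>. \<bar>Poly_Mapping.lookup q \<alpha> / multinom (tdeg q) \<alpha>\<bar>) ` {\<alpha>. exp_sum \<alpha> \<le> tdeg q})"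

text \<open>The set over which the maximum is taken is finite.\<close>

lemma finite_exp_sum_le: "finite {\<alpha> :: 'n::finite \<Rightarrow>\<^sub>0 nat. exp_sum \<alpha> \<le> d}"
proof (rule finite_imageD)
  have "Poly_Mapping.lookup \<alpha> i \<le> d" if "exp_sum \<alpha> \<le> d" for \<alpha> :: "'n \<Rightarrow>\<^sub>0 nat" and i
    using that member_le_sum[of i UNIV "Poly_Mapping.lookup \<alpha>"] by (simp add: exp_sum_def)
  then have "Poly_Mapping.lookup ` {\<alpha> :: 'n \<Rightarrow>\<^sub>0 nat. exp_sum \<alpha> \<le> d} \<subseteq> Pi\<^sub>E UNIV (\<lambda>_. {..d})"
    by auto
  then show "finite (Poly_Mapping.lookup ` {\<alpha> :: 'n \<Rightarrow>\<^sub>0 nat. exp_sum \<alpha> \<le> d})"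
    by (rule finite_subset) (simp add: finite_PiE)
  show "inj_on Poly_Mapping.lookup {\<alpha> :: 'n \<Rightarrow>\<^sub>0 nat. exp_sum \<alpha> \<le> d}"
    by (simp add: inj_on_def)
qed

text \<open>Used both for multivariate and for univariate real polynomials.\<close>

definition sos :: "'a::comm_semiring_1 \<Rightarrow> bool" where
  "sos p \<longleftrightarrow> (\<exists>qs. p = (\<Sum>q\<leftarrow>qs. q ^ 2))"

text \<open>Composition \<open>\<rho>(q(x))\<close> of a univariate with a multivariate polynomial.\<close>

definition subst_poly :: "real poly \<Rightarrow> 'n::finite mpoly \<Rightarrow> 'n mpoly" where
  "subst_poly \<rho> q = poly (map_poly Const \<rho>) q"

definition feasible_set :: "('m::finite \<Rightarrow> 'n::finite mpoly) \<Rightarrow> (real ^ 'n) set" where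
  "feasible_set g = {x. \<forall>j. meval (g j) x \<ge> 0}"

text \<open>
  The \<open>n + m + 1\<close> entries are indexed by the sum type: \<open>Inl\<close> for \<open>x - L\<close>,
  \<open>Inr \<circ> Inl\<close> for \<open>g\<close>, and \<open>Inr (Inr ())\<close> for the last entry.
\<close>

definition ghat ::
  "('m::finite \<Rightarrow> 'n::finite mpoly) \<Rightarrow> real ^ 'n \<Rightarrow> real \<Rightarrow> 'n + 'm + unit \<Rightarrow> 'n mpoly" where
  "ghat g L Mh k = (case k of
       Inl i \<Rightarrow> Var i - Const (L $ i)
     | Inr (Inl j) \<Rightarrow> g j
     | Inr (Inr _) \<Rightarrow> Const Mh - (\<Sum>i\<in>UNIV. Var i) - (\<Sum>j\<in>UNIV. g j))"

end

theory Submission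
  imports Defs
begin

text \<open>
  Write \<open>b\<close> for the ball polynomial \<open>Mh\<^sup>2 - \<Sum>k. (ghat k)\<^sup>2\<close>.  The idea is to
  subtract from \<open>p\<close> a penalty \<open>\<rho>(h) h\<close> for each of the polynomials \<open>h\<close> among the
  \<open>ghat k\<close> and \<open>b\<close>, with the univariate square \<open>\<rho>(t) = (1 - t / R) ^ (2 * N)\<close>.  Where
  \<open>h \<ge> 0\<close> the penalty is negligible for large \<open>N\<close>; where \<open>h\<close> is negative, it is so
  strongly negative that subtracting it makes the difference positive.  Since \<open>p > 0\<close> where no
  \<open>h\<close> is negative, the difference becomes positive on any compact set fixed in advance
  (\<open>positive_minus_penalties\<close>).  The penalties have exactly the shape that the representation
  admits: that of \<open>ghat k\<close> contributes to \<open>\<rho> k\<close>, that of \<open>b\<close> to \<open>\<sigma>1\<close>.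

  It remains to write a polynomial that is positive on a box as \<open>\<sigma>0 + \<sigma>1 * b\<close>.  These
  expressions form a semiring, because \<open>b\<^sup>2\<close> is a square (\<open>generated_preordering_mult\<close>).
  Up to squares, \<open>b\<close> is \<open>Mh\<^sup>2 - (x $ i - L $ i)\<^sup>2\<close>, and so the semiring contains the
  linear polynomials that bound the coordinates on a suitable box
  (\<open>scaled_coordinate_mem_generated_preordering\<close>).  Products of these are the Bernstein basis
  polynomials of the box, and a polynomial that is positive on the box has positive coefficients
  in the Bernstein basis of some degree (\<open>positive_on_box_imp_mem\<close>).
\<close>

section \<open>Polynomials as functions\<close>

lemma Const_0 [simp]: "Const 0 = 0"
  and Const_1 [simp]: "Const 1 = 1"
  by (simp_all add: Const_def)

lemma Const_add: "Const (a + b) = Const a + Const b"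
  by (simp add: Const_def single_add)

lemma Const_mult: "Const (a * b) = Const a * Const b"
  by (simp add: Const_def mult_single)

lemma Const_uminus: "Const (- a) = - Const a"
  by (metis Const_0 Const_add add.right_inverse minus_unique)

lemma Const_diff: "Const (a - b) = Const a - Const b"
  using Const_add[of a "- b"] by (simp add: Const_uminus)

lemma Const_power: "Const (a ^ k) = Const a ^ k"
  by (induction k) (simp_all add: Const_mult)

lemma Const_of_nat: "Const (of_nat k) = of_nat k"
  by (induction k) (simp_all add: Const_add)

lemma Const_prod: "Const (prod f A) = (\<Prod>i\<in>A. Const (f i))"
  by (induction A rule: infinite_finite_induct) (simp_all add: Const_mult)

lemma update_eq_add_single:
  fixes f :: "'a \<Rightarrow>\<^sub>0 'b::monoid_add"
  assumes "a \<notin> Poly_Mapping.keys f"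
  shows "Poly_Mapping.update a b f = f + Poly_Mapping.single a b"
  using assms
  by (intro poly_mapping_eqI) (auto simp: lookup_update lookup_add lookup_single in_keys_iff when_def)

lemma poly_mapping_induct_single_add:
  fixes f :: "'a \<Rightarrow>\<^sub>0 'b::monoid_add"
  assumes "P 0" and "\<And>f a b. P f \<Longrightarrow> P (f + Poly_Mapping.single a b)"
  shows "P f"
  by (induction f rule: update_induct) (simp_all add: assms update_eq_add_single)

lemma Var_power: "Var i ^ k = Poly_Mapping.single (Poly_Mapping.single i k) 1"
proof (induction k)
  case (Suc k)
  have "Poly_Mapping.single i (Suc 0) + Poly_Mapping.single i k = Poly_Mapping.single i (Suc k)"
    by (metis plus_1_eq_Suc One_nat_def single_add)
  with Suc show ?case
    by (simp add: Var_def mult_single)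
qed simp

lemma mpoly_induct [case_names Const Var add mult]:
  fixes f :: "'n::finite mpoly"
  assumes C: "\<And>c. P (Const c)" and V: "\<And>i. P (Var i)"
    and A: "\<And>f g. P f \<Longrightarrow> P g \<Longrightarrow> P (f + g)" and M: "\<And>f g. P f \<Longrightarrow> P g \<Longrightarrow> P (f * g)"
  shows "P f"
proof -
  have pow: "P (Var i ^ k)" for i k
    using C[of 1] by (induction k) (simp_all add: V M)
  have mono: "P (Poly_Mapping.single \<alpha> c)" for \<alpha> c
  proof (induction \<alpha> rule: poly_mapping_induct_single_add)
    case 1
    show ?case using C[of c] by (simp add: Const_def)
  next
    case (2 \<alpha> i k)
    have "Poly_Mapping.single (\<alpha> + Poly_Mapping.single i k) c = Poly_Mapping.single \<alpha> c * Var i ^ k"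
      by (simp add: Var_power mult_single)
    then show ?case using 2 pow M by metis
  qed
  show ?thesis
    using C[of 0] by (induction f rule: poly_mapping_induct_single_add) (simp_all add: A mono)
qed

lemma meval_superset:
  assumes "finite A" and "Poly_Mapping.keys p \<subseteq> A"
  shows "meval p x = (\<Sum>\<alpha>\<in>A. Poly_Mapping.lookup p \<alpha> * (\<Prod>i\<in>UNIV. (x $ i) ^ Poly_Mapping.lookup \<alpha> i))"
  unfolding meval_def using assms
  by (intro sum.mono_neutral_left) (auto simp: in_keys_iff)

lemma meval_add [simp]: "meval (p + q) x = meval p x + meval q x"
proof -
  let ?A = "Poly_Mapping.keys p \<union> Poly_Mapping.keys q"
  have "Poly_Mapping.keys (p + q) \<subseteq> ?A" by (rule keys_add)
  then show ?thesis
    by (simp add: meval_superset[of ?A] lookup_add distrib_right sum.distrib)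
qed

lemma meval_0 [simp]: "meval 0 x = 0"
  by (simp add: meval_def)

lemma meval_single:
  "meval (Poly_Mapping.single \<alpha> c) x = c * (\<Prod>i\<in>UNIV. (x $ i) ^ Poly_Mapping.lookup \<alpha> i)"
  by (cases "c = 0") (simp_all add: meval_def)

lemma meval_Const [simp]: "meval (Const c) x = c"
  by (simp add: Const_def meval_single)

lemma meval_1 [simp]: "meval 1 x = 1"
  using meval_Const[of 1 x] by simp

lemma meval_Var [simp]: "meval (Var i) x = x $ i"
proof -
  have "(\<Prod>j\<in>UNIV. (x $ j) ^ Poly_Mapping.lookup (Poly_Mapping.single i (1::nat)) j)
      = (\<Prod>j\<in>UNIV. if j = i then x $ i else 1)"
    by (intro prod.cong) (auto simp: lookup_single when_def)
  then show ?thesis by (simp add: Var_def meval_single)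
qed

lemma meval_mult [simp]: "meval (p * q) x = meval p x * meval q x"
proof -
  have single: "meval (Poly_Mapping.single \<alpha> c * q) x = meval (Poly_Mapping.single \<alpha> c) x * meval q x" for \<alpha> c
    by (induction q rule: poly_mapping_induct_single_add)
      (simp_all add: distrib_left mult_single meval_single lookup_add power_add prod.distrib)
  show ?thesis
    by (induction p rule: poly_mapping_induct_single_add) (simp_all add: distrib_right single)
qed

lemma meval_uminus [simp]: "meval (- p) x = - meval p x"
  by (metis meval_0 meval_add add.right_inverse minus_unique)

lemma meval_diff [simp]: "meval (p - q) x = meval p x - meval q x"
  using meval_add[of p "- q" x] by simp

lemma meval_power [simp]: "meval (p ^ k) x = meval p x ^ k"
  by (induction k) simp_all

lemma meval_sum [simp]: "meval (sum f A) x = (\<Sum>i\<in>A. meval (f i) x)"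
  by (induction A rule: infinite_finite_induct) simp_all

lemma meval_prod [simp]: "meval (prod f A) x = (\<Prod>i\<in>A. meval (f i) x)"
  by (induction A rule: infinite_finite_induct) simp_all

lemma continuous_on_meval [continuous_intros]: "continuous_on S (meval p)"
  unfolding meval_def by (intro continuous_intros)

lemma subst_linear_power:
  "subst_poly ([:a, b:] ^ k) q = (Const a + Const b * q) ^ k"
proof (induction k)
  case 0
  show ?case by (simp add: subst_poly_def map_poly_1')
next
  case (Suc k)
  have map_add: "map_poly Const (r + s) = map_poly Const r + (map_poly Const s :: 'n::finite mpoly poly)"
    for r s
    by (intro poly_eqI) (simp add: coeff_map_poly Const_add)
  show ?case
    using Suc
    by (simp add: subst_poly_def map_add map_poly_smult map_poly_pCons Const_mult algebra_simps)
qed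

section \<open>Sums of squares and the preordering of one polynomial\<close>

lemma sos_square: "sos (q ^ 2)"
  unfolding sos_def by (rule exI[of _ "[q]"]) simp

lemma sos_0: "sos 0"
  unfolding sos_def by (rule exI[of _ "[]"]) simp

lemma sos_1: "sos 1"
  using sos_square[of 1] by simp

lemma sos_add: "sos p \<Longrightarrow> sos q \<Longrightarrow> sos (p + q)"
  unfolding sos_def by (metis map_append sum_list.append)

lemma sos_sum: "(\<And>i. i \<in> A \<Longrightarrow> sos (f i)) \<Longrightarrow> sos (sum f A)"
  by (induction A rule: infinite_finite_induct) (simp_all add: sos_0 sos_add)

lemma sos_mult:
  assumes "sos p" and "sos q"
  shows "sos (p * q)"
proof -
  obtain ps qs where p: "p = (\<Sum>r\<leftarrow>ps. r ^ 2)" and q: "q = (\<Sum>r\<leftarrow>qs. r ^ 2)"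
    using assms by (auto simp: sos_def)
  have square: "sos (a ^ 2 * q)" for a
    unfolding q by (induction qs) (simp_all add: sos_0 sos_add sos_square distrib_left flip: power_mult_distrib)
  show ?thesis
    unfolding p by (induction ps) (simp_all add: sos_0 sos_add square distrib_right)
qed

lemma sos_Const: "c \<ge> 0 \<Longrightarrow> sos (Const c)"
  using sos_square[of "Const (sqrt c)"] by (simp flip: Const_power)

definition generated_preordering :: "'a::comm_semiring_1 \<Rightarrow> 'a set" where
  "generated_preordering b = {\<sigma>0 + \<sigma>1 * b |\<sigma>0 \<sigma>1. sos \<sigma>0 \<and> sos \<sigma>1}"

lemma generated_preordering_sos: "sos p \<Longrightarrow> p \<in> generated_preordering b"
  unfolding generated_preordering_def using sos_0 by force

lemma generated_preordering_generator: "b \<in> generated_preordering b"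
  unfolding generated_preordering_def using sos_0 sos_1 by force

lemma generated_preordering_add:
  assumes "p \<in> generated_preordering b" and "q \<in> generated_preordering b"
  shows "p + q \<in> generated_preordering b"
proof -
  obtain s0 s1 t0 t1 where "p = s0 + s1 * b" "q = t0 + t1 * b" "sos s0" "sos s1" "sos t0" "sos t1"
    using assms by (auto simp: generated_preordering_def)
  then have "p + q = (s0 + t0) + (s1 + t1) * b" "sos (s0 + t0)" "sos (s1 + t1)"
    by (simp_all add: algebra_simps sos_add)
  then show ?thesis unfolding generated_preordering_def by blast
qed

text \<open>
  Because the generator is a single polynomial, the only new product is its square, which is a
  sum of squares.
\<close>

lemma generated_preordering_mult:
  assumes "p \<in> generated_preordering b" and "q \<in> generated_preordering b"
  shows "p * q \<in> generated_preordering b"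
proof -
  obtain s0 s1 t0 t1 where "p = s0 + s1 * b" "q = t0 + t1 * b"
    and s: "sos s0" "sos s1" "sos t0" "sos t1"
    using assms by (auto simp: generated_preordering_def)
  then have "p * q = (s0 * t0 + s1 * t1 * b ^ 2) + (s0 * t1 + s1 * t0) * b"
    by (simp add: algebra_simps power2_eq_square)
  moreover have "sos (s0 * t0 + s1 * t1 * b ^ 2)" "sos (s0 * t1 + s1 * t0)"
    using s by (auto intro!: sos_add sos_mult sos_square)
  ultimately show ?thesis unfolding generated_preordering_def by blast
qed

section \<open>Bernstein coefficients of a polynomial positive on a box\<close>

text \<open>
  The coefficient of \<open>t ^ a\<close> at index \<open>k\<close> in the Bernstein basis of degree \<open>d\<close>
  on \<open>[0, 1]\<close>.
\<close>

definition bernstein_coeff :: "nat \<Rightarrow> nat \<Rightarrow> nat \<Rightarrow> real" where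
  "bernstein_coeff d a k = real (k choose a) / real (d choose a)"

lemma bernstein_coeff_bounds:
  assumes "k \<le> d"
  shows "0 \<le> bernstein_coeff d a k" and "bernstein_coeff d a k \<le> 1"
  using binomial_right_mono[OF assms, of a]
  by (auto simp: bernstein_coeff_def divide_le_eq_1)

lemma bernstein_coeff_Suc:
  assumes "a < d"
  shows "bernstein_coeff d (Suc a) k = bernstein_coeff d a k * (real (k - a) / real (d - a))"
proof -
  have step: "real (n choose Suc a) = real (n choose a) * real (n - a) / real (Suc a)" for n
  proof -
    have "(n choose Suc a) * Suc a = (n choose a) * (n - a)"
      by (metis binomial_absorb_comp binomial_absorption mult.commute)
    then have "real (n choose Suc a) * real (Suc a) = real (n choose a) * real (n - a)"
      by (metis of_nat_mult)
    then show ?thesis by (simp add: field_simps)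
  qed
  show ?thesis
    unfolding bernstein_coeff_def step by (simp add: field_simps del: of_nat_Suc)
qed

text \<open>
  The coefficient is a product of the factors \<open>(k - j) / (d - j)\<close> for \<open>j < a\<close>, each within
  \<open>j / (d - j)\<close> of \<open>k / d\<close>.
\<close>

lemma bernstein_coeff_approx:
  assumes "e > 0"
  shows "\<exists>D. \<forall>d\<ge>D. \<forall>k\<le>d. \<bar>bernstein_coeff d a k - (real k / real d) ^ a\<bar> \<le> e"
  using assms
proof (induction a arbitrary: e)
  case 0
  then show ?case by (auto simp: bernstein_coeff_def)
next
  case (Suc a)
  obtain D where D: "\<And>d k. d \<ge> D \<Longrightarrow> k \<le> d \<Longrightarrow> \<bar>bernstein_coeff d a k - (real k / real d) ^ a\<bar> \<le> e / 2"
    using Suc.IH[of "e / 2"] Suc.prems by auto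
  obtain m where m: "2 * real a / e \<le> real m" using real_arch_simple by blast
  show ?case
  proof (intro exI allI impI)
    fix d k assume d: "D + a + m + 1 \<le> d" and k: "k \<le> d"
    have ad: "a < d" and da: "real m < real d - real a" using d by linarith+
    have small: "real a / (real d - real a) \<le> e / 2"
    proof -
      have "2 * real a \<le> e * real m" using m Suc.prems by (simp add: field_simps)
      also have "\<dots> \<le> e * (real d - real a)" using da Suc.prems by (intro mult_left_mono) auto
      finally show ?thesis using ad by (simp add: field_simps)
    qed
    let ?r = "real (k - a) / real (d - a)" and ?t = "real k / real d" and ?c = "bernstein_coeff d a k"
    have rt: "\<bar>?r - ?t\<bar> \<le> real a / (real d - real a)"
    proof (cases "a \<le> k")
      case True
      have "?t - ?r = real a * (real d - real k) / (real d * (real d - real a))"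
        using True ad by (simp add: of_nat_diff field_simps)
      also have "\<dots> = real a / (real d - real a) * ((real d - real k) / real d)" by simp
      finally have eq: "?t - ?r = real a / (real d - real a) * ((real d - real k) / real d)" .
      have "(real d - real k) / real d \<le> 1" "0 \<le> (real d - real k) / real d" "0 \<le> real a / (real d - real a)"
        using k ad by (simp_all add: divide_le_eq_1)
      then have "0 \<le> ?t - ?r" "?t - ?r \<le> real a / (real d - real a)"
        unfolding eq by (blast intro: mult_nonneg_nonneg mult_left_le)+
      then show ?thesis by (simp only: abs_minus_commute[of ?r] abs_of_nonneg)
    next
      case False
      then have "?t \<le> real a / (real d - real a)" using ad by (intro frac_le) auto
      then show ?thesis using False by simp
    qed
    have "?c * ?r - ?t ^ Suc a = ?c * (?r - ?t) + (?c - ?t ^ a) * ?t"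
      by (simp add: algebra_simps)
    also have "\<bar>\<dots>\<bar> \<le> \<bar>?c\<bar> * \<bar>?r - ?t\<bar> + \<bar>?c - ?t ^ a\<bar> * \<bar>?t\<bar>"
      by (metis abs_triangle_ineq abs_mult)
    also have "\<dots> \<le> 1 * \<bar>?r - ?t\<bar> + \<bar>?c - ?t ^ a\<bar> * 1"
      using bernstein_coeff_bounds[OF k, of a] k ad
      by (intro add_mono mult_right_mono mult_left_mono) (auto simp: divide_le_eq_1)
    also have "\<dots> \<le> e / 2 + e / 2"
    proof -
      have "\<bar>?c - ?t ^ a\<bar> \<le> e / 2" using d k by (intro D) auto
      then show ?thesis unfolding mult_1_left mult_1_right
        by (rule add_mono[OF order_trans[OF rt small]])
    qed
    finally show "\<bar>bernstein_coeff d (Suc a) k - ?t ^ Suc a\<bar> \<le> e"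
      by (simp add: bernstein_coeff_Suc[OF ad])
  qed
qed

definition bernstein_basis :: "('n \<Rightarrow> 'n mpoly) \<Rightarrow> nat \<Rightarrow> ('n \<Rightarrow> nat) \<Rightarrow> 'n::finite mpoly" where
  "bernstein_basis u d \<kappa> = (\<Prod>i\<in>UNIV. of_nat (d choose \<kappa> i) * u i ^ \<kappa> i * (1 - u i) ^ (d - \<kappa> i))"

abbreviation grid_indices :: "nat \<Rightarrow> ('n \<Rightarrow> nat) set" where
  "grid_indices d \<equiv> PiE UNIV (\<lambda>_. {..d})"

text \<open>Multiply \<open>u ^ a\<close> by \<open>1 = (u + (1 - u)) ^ (d - a)\<close> and expand.\<close>

lemma power_eq_bernstein_sum:
  fixes u :: "'n::finite mpoly"
  assumes "a \<le> d"
  shows "u ^ a = (\<Sum>k\<le>d. Const (bernstein_coeff d a k) * (of_nat (d choose k) * u ^ k * (1 - u) ^ (d - k)))"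
    (is "_ = sum ?F _")
proof -
  have "u ^ a = u ^ a * (u + (1 - u)) ^ (d - a)" by simp
  also have "\<dots> = (\<Sum>j\<le>d - a. of_nat (d - a choose j) * u ^ (j + a) * (1 - u) ^ (d - a - j))"
    unfolding binomial_ring sum_distrib_left by (simp add: power_add mult_ac)
  also have "\<dots> = (\<Sum>j\<le>d - a. ?F (j + a))"
  proof (rule sum.cong)
    fix j assume "j \<in> {..d - a}"
    then have le: "j + a \<le> d" using assms by simp
    have "(d choose (j + a)) * ((j + a) choose a) = (d choose a) * ((d - a) choose j)"
      using choose_mult[of a "j + a" d] le by simp
    then have "real (d choose (j + a)) * real ((j + a) choose a) = real (d choose a) * real ((d - a) choose j)"
      by (metis of_nat_mult)
    then have "real (d - a choose j) = bernstein_coeff d a (j + a) * real (d choose (j + a))"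
      using assms by (simp add: bernstein_coeff_def field_simps)
    then have "(of_nat (d - a choose j) :: 'n mpoly) = Const (bernstein_coeff d a (j + a)) * of_nat (d choose (j + a))"
      by (metis Const_mult Const_of_nat)
    then show "of_nat (d - a choose j) * u ^ (j + a) * (1 - u) ^ (d - a - j) = ?F (j + a)"
      by (simp add: mult_ac add.commute)
  qed simp
  also have "\<dots> = sum ?F {a..d}"
    by (rule sum.reindex_bij_witness[of _ "\<lambda>k. k - a" "\<lambda>j. j + a"]) (use assms in auto)
  also have "\<dots> = sum ?F {..d}"
    by (rule sum.mono_neutral_left) (auto simp: bernstein_coeff_def binomial_eq_0)
  finally show ?thesis .
qed

lemma monomial_eq_bernstein_sum:
  fixes u :: "'n::finite \<Rightarrow> 'n mpoly"
  assumes "\<And>i. \<alpha> i \<le> d"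
  shows "(\<Prod>i\<in>UNIV. u i ^ \<alpha> i)
    = (\<Sum>\<kappa>\<in>grid_indices d. Const (\<Prod>i\<in>UNIV. bernstein_coeff d (\<alpha> i) (\<kappa> i)) * bernstein_basis u d \<kappa>)"
  by (subst power_eq_bernstein_sum[OF assms], subst prod_sum_PiE)
    (simp_all add: Const_prod bernstein_basis_def prod.distrib)

text \<open>
  Writing a polynomial as a linear combination of monomials in the scaled coordinates \<open>u i\<close>
  reduces the approximation of its Bernstein coefficients to the case of monomials.
\<close>

inductive monomial_span :: "('n \<Rightarrow> 'n mpoly) \<Rightarrow> 'n::finite mpoly \<Rightarrow> bool" for u where
  monomial: "monomial_span u (Const c * (\<Prod>i\<in>UNIV. u i ^ \<alpha> i))"
| add: "monomial_span u f \<Longrightarrow> monomial_span u g \<Longrightarrow> monomial_span u (f + g)"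

lemma monomial_span_mult:
  assumes "monomial_span u f" and "monomial_span u g"
  shows "monomial_span u (f * g)"
  using assms(1)
proof (induction rule: monomial_span.induct)
  case (monomial c \<alpha>)
  show ?case
    using assms(2)
  proof (induction rule: monomial_span.induct)
    case (monomial c' \<beta>)
    have "Const c * (\<Prod>i\<in>UNIV. u i ^ \<alpha> i) * (Const c' * (\<Prod>i\<in>UNIV. u i ^ \<beta> i))
      = Const (c * c') * (\<Prod>i\<in>UNIV. u i ^ (\<alpha> i + \<beta> i))"
      by (simp add: Const_mult power_add prod.distrib mult_ac)
    then show ?case by (metis monomial_span.monomial)
  qed (simp add: distrib_left monomial_span.add)
qed (simp add: distrib_right monomial_span.add)

lemma monomial_span_affine:
  assumes "w \<noteq> 0" and u: "\<And>i. u i = Const (1 / w) * (Var i - Const (l $ i))"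
  shows "monomial_span u f"
proof (induction f rule: mpoly_induct)
  case (Const c)
  show ?case using monomial_span.monomial[of u c "\<lambda>_. 0"] by simp
next
  case (Var i)
  have "Const w * u i = Var i - Const (l $ i)"
    using assms(1) by (simp add: u flip: mult.assoc Const_mult)
  moreover have "(\<Prod>j\<in>UNIV. u j ^ (if j = i then 1 else 0)) = u i"
    by (subst prod.remove[of _ i]) auto
  ultimately have Var: "Var i = Const w * (\<Prod>j\<in>UNIV. u j ^ (if j = i then 1 else 0))
      + Const (l $ i) * (\<Prod>j\<in>UNIV. u j ^ 0)"
    by simp
  show ?case unfolding Var by (intro monomial_span.intros)
qed (auto intro: monomial_span.add monomial_span_mult)

text \<open>
  The Bernstein coefficient at a multi-index tends to the value at the grid point with that
  multi-index, uniformly in the multi-index.  For a monomial both are products of factors in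
  \<open>[0, 1]\<close> that are close to each other; sums preserve the property.
\<close>

lemma bernstein_coefficients_near_values:
  fixes l :: "real ^ 'n::finite" and f :: "'n mpoly"
  assumes w: "w > 0" and u: "\<And>i. u i = Const (1 / w) * (Var i - Const (l $ i))" and "e > 0"
  shows "\<exists>D. \<forall>d\<ge>D. \<exists>b. f = (\<Sum>\<kappa>\<in>grid_indices d. Const (b \<kappa>) * bernstein_basis u d \<kappa>) \<and>
    (\<forall>\<kappa>\<in>grid_indices d. \<bar>b \<kappa> - meval f (\<chi> i. l $ i + w * (real (\<kappa> i) / real d))\<bar> \<le> e)"
proof -
  have "monomial_span u f"
    using w u by (intro monomial_span_affine) auto
  then show ?thesis
    using \<open>e > 0\<close>
  proof (induction arbitrary: e rule: monomial_span.induct)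
    case (monomial c \<alpha>)
    \<comment> \<open>Each of the factors, one per variable, may contribute this error, which is then scaled
       by \<open>c\<close>.  Adding 1 keeps the denominator positive if \<open>c = 0\<close>.\<close>
    define e' where "e' = e / ((\<bar>c\<bar> + 1) * real CARD('n))"
    have "e' > 0" using monomial by (simp add: e'_def)
    then have "\<forall>i. \<exists>D. \<forall>d\<ge>D. \<forall>k\<le>d. \<bar>bernstein_coeff d (\<alpha> i) k - (real k / real d) ^ \<alpha> i\<bar> \<le> e'"
      using bernstein_coeff_approx by blast
    then obtain D where D: "\<And>i d k. d \<ge> D i \<Longrightarrow> k \<le> d \<Longrightarrow>
        \<bar>bernstein_coeff d (\<alpha> i) k - (real k / real d) ^ \<alpha> i\<bar> \<le> e'"
      by metis
    show ?case
    proof (intro exI allI impI conjI ballI)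
      fix d assume d: "(\<Sum>i\<in>UNIV. D i + \<alpha> i) \<le> d"
      have le: "D i + \<alpha> i \<le> d" for i
        using member_le_sum[of i UNIV "\<lambda>i. D i + \<alpha> i"] d by simp
      let ?b = "\<lambda>\<kappa>. c * (\<Prod>i\<in>UNIV. bernstein_coeff d (\<alpha> i) (\<kappa> i))"
      show "Const c * (\<Prod>i\<in>UNIV. u i ^ \<alpha> i) = (\<Sum>\<kappa>\<in>grid_indices d. Const (?b \<kappa>) * bernstein_basis u d \<kappa>)"
        using le by (subst monomial_eq_bernstein_sum[of \<alpha> d])
          (auto simp: sum_distrib_left Const_mult mult.assoc intro: add_leD2)
      fix \<kappa> :: "'n \<Rightarrow> nat" assume "\<kappa> \<in> grid_indices d"
      then have \<kappa>: "\<kappa> i \<le> d" for i by auto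
      have \<kappa>1: "real (\<kappa> i) / real d \<le> 1" for i
        using \<kappa>[of i] by (cases "d = 0") auto
      have "\<bar>(\<Prod>i\<in>UNIV. bernstein_coeff d (\<alpha> i) (\<kappa> i)) - (\<Prod>i\<in>UNIV. (real (\<kappa> i) / real d) ^ \<alpha> i)\<bar>
          \<le> (\<Sum>i\<in>UNIV. \<bar>bernstein_coeff d (\<alpha> i) (\<kappa> i) - (real (\<kappa> i) / real d) ^ \<alpha> i\<bar>)"
        using norm_prod_diff[of UNIV "\<lambda>i. bernstein_coeff d (\<alpha> i) (\<kappa> i)" "\<lambda>i. (real (\<kappa> i) / real d) ^ \<alpha> i"]
          bernstein_coeff_bounds[OF \<kappa>] \<kappa>1
        by (simp add: power_le_one)
      also have "\<dots> \<le> (\<Sum>i\<in>(UNIV :: 'n set). e')"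
        using D \<kappa> le by (intro sum_mono) (meson add_leD1)
      also have "\<dots> = e / (\<bar>c\<bar> + 1)" by (simp add: e'_def)
      finally have *: "\<bar>(\<Prod>i\<in>UNIV. bernstein_coeff d (\<alpha> i) (\<kappa> i)) - (\<Prod>i\<in>UNIV. (real (\<kappa> i) / real d) ^ \<alpha> i)\<bar>
        \<le> e / (\<bar>c\<bar> + 1)" .
      have "\<bar>?b \<kappa> - c * (\<Prod>i\<in>UNIV. (real (\<kappa> i) / real d) ^ \<alpha> i)\<bar> \<le> \<bar>c\<bar> * (e / (\<bar>c\<bar> + 1))"
        using mult_left_mono[OF *, of "\<bar>c\<bar>"] by (simp add: right_diff_distrib flip: abs_mult)
      also have "\<dots> \<le> e" using monomial by (simp add: field_simps)
      finally show "\<bar>?b \<kappa> - meval (Const c * (\<Prod>i\<in>UNIV. u i ^ \<alpha> i))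
          (\<chi> i. l $ i + w * (real (\<kappa> i) / real d))\<bar> \<le> e"
        using w by (simp add: u)
    qed
  next
    case (add f g)
    let ?x = "\<lambda>d \<kappa>. \<chi> i. l $ i + w * (real (\<kappa> i) / real d)"
    let ?near = "\<lambda>h d b. h = (\<Sum>\<kappa>\<in>grid_indices d. Const (b \<kappa>) * bernstein_basis u d \<kappa>) \<and>
      (\<forall>\<kappa>\<in>grid_indices d. \<bar>b \<kappa> - meval h (?x d \<kappa>)\<bar> \<le> e / 2)"
    have e2: "e / 2 > 0" using add.prems by simp
    obtain D1 where D1: "\<forall>d\<ge>D1. \<exists>b. ?near f d b" using add.IH(1)[OF e2] by (rule exE)
    obtain D2 where D2: "\<forall>d\<ge>D2. \<exists>b. ?near g d b" using add.IH(2)[OF e2] by (rule exE)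
    show ?case
    proof (intro exI[of _ "max D1 D2"] allI impI)
      fix d assume d: "max D1 D2 \<le> d"
      have "\<exists>b. ?near f d b" using D1[rule_format, of d] d by simp
      then obtain b1 where b1: "?near f d b1" by (rule exE)
      have "\<exists>b. ?near g d b" using D2[rule_format, of d] d by simp
      then obtain b2 where b2: "?near g d b2" by (rule exE)
      have "f + g = (\<Sum>\<kappa>\<in>grid_indices d. Const (b1 \<kappa> + b2 \<kappa>) * bernstein_basis u d \<kappa>)"
        using b1 b2 by (simp add: Const_add distrib_right sum.distrib)
      moreover have "\<bar>(b1 \<kappa> + b2 \<kappa>) - meval (f + g) (?x d \<kappa>)\<bar> \<le> e" if "\<kappa> \<in> grid_indices d" for \<kappa>
      proof -
        have "\<bar>b1 \<kappa> - meval f (?x d \<kappa>)\<bar> \<le> e / 2" "\<bar>b2 \<kappa> - meval g (?x d \<kappa>)\<bar> \<le> e / 2"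
          using b1 b2 that by blast+
        then show ?thesis unfolding meval_add by linarith
      qed
      ultimately show "\<exists>b. f + g = (\<Sum>\<kappa>\<in>grid_indices d. Const (b \<kappa>) * bernstein_basis u d \<kappa>) \<and>
        (\<forall>\<kappa>\<in>grid_indices d. \<bar>b \<kappa> - meval (f + g) (?x d \<kappa>)\<bar> \<le> e)"
        by (intro exI[of _ "\<lambda>\<kappa>. b1 \<kappa> + b2 \<kappa>"]) blast
    qed
  qed
qed

text \<open>
  On the box the polynomial is bounded below by a positive number, so for a large degree all
  its Bernstein coefficients are positive.  The Bernstein expansion then builds it from the
  scaled coordinates \<open>u i\<close> and their complements by sums and products.
\<close>

lemma positive_on_box_imp_mem:
  fixes l :: "real ^ 'n::finite" and f :: "'n mpoly"
  assumes w: "w > 0" and u: "\<And>i. u i = Const (1 / w) * (Var i - Const (l $ i))"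
    and pos: "\<And>x. x \<in> cbox l (\<chi> i. l $ i + w) \<Longrightarrow> meval f x > 0"
    and P_const: "\<And>c. c \<ge> 0 \<Longrightarrow> Const c \<in> P"
    and P_add: "\<And>p q. p \<in> P \<Longrightarrow> q \<in> P \<Longrightarrow> p + q \<in> P"
    and P_mult: "\<And>p q. p \<in> P \<Longrightarrow> q \<in> P \<Longrightarrow> p * q \<in> P"
    and P_u: "\<And>i. u i \<in> P" "\<And>i. 1 - u i \<in> P"
  shows "f \<in> P"
proof -
  let ?K = "cbox l (\<chi> i. l $ i + w)"
  have "l \<in> ?K" using w by (simp add: mem_box_cart)
  then have "?K \<noteq> {}" by blast
  then have "\<exists>z\<in>?K. \<forall>x\<in>?K. meval f z \<le> meval f x"
    by (intro continuous_attains_inf compact_cbox continuous_on_meval)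
  then obtain z where z: "z \<in> ?K" "\<And>x. x \<in> ?K \<Longrightarrow> meval f z \<le> meval f x" by blast
  obtain D where D: "\<forall>d\<ge>D. \<exists>b. f = (\<Sum>\<kappa>\<in>grid_indices d. Const (b \<kappa>) * bernstein_basis u d \<kappa>) \<and>
      (\<forall>\<kappa>\<in>grid_indices d. \<bar>b \<kappa> - meval f (\<chi> i. l $ i + w * (real (\<kappa> i) / real d))\<bar> \<le> meval f z)"
    using bernstein_coefficients_near_values[where u = u and l = l and f = f, OF w u pos[OF z(1)]]
    by (rule exE)
  obtain b where f: "f = (\<Sum>\<kappa>\<in>grid_indices D. Const (b \<kappa>) * bernstein_basis u D \<kappa>)"
    and b: "\<And>\<kappa>. \<kappa> \<in> grid_indices D \<Longrightarrow>
      \<bar>b \<kappa> - meval f (\<chi> i. l $ i + w * (real (\<kappa> i) / real D))\<bar> \<le> meval f z"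
    using D[rule_format, OF order_refl] by (elim exE conjE) (rule that, assumption, erule bspec)
  have P0: "0 \<in> P" and P1: "1 \<in> P" using P_const[of 0] P_const[of 1] by simp_all
  have P_sum: "(\<And>i. i \<in> A \<Longrightarrow> h i \<in> P) \<Longrightarrow> sum h A \<in> P" for A :: "('n \<Rightarrow> nat) set" and h
    by (induction A rule: infinite_finite_induct) (simp_all add: P0 P_add)
  have P_prod: "(\<And>i. i \<in> A \<Longrightarrow> h i \<in> P) \<Longrightarrow> prod h A \<in> P" for A :: "'n set" and h
    by (induction A rule: infinite_finite_induct) (simp_all add: P1 P_mult)
  have P_power: "p \<in> P \<Longrightarrow> p ^ k \<in> P" for p k
    by (induction k) (simp_all add: P1 P_mult)
  have P_nat: "of_nat k \<in> P" for k
    using P_const[of "real k"] by (simp add: Const_of_nat)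
  have "b \<kappa> \<ge> 0" if "\<kappa> \<in> grid_indices D" for \<kappa>
  proof -
    have "\<kappa> i \<le> D" for i using that by auto
    then have "real (\<kappa> i) / real D \<le> 1" for i
      by (cases "D = 0") auto
    then have "(\<chi> i. l $ i + w * (real (\<kappa> i) / real D)) \<in> ?K"
      using w by (simp add: mem_box_cart mult_left_le del: times_divide_eq_right)
    from z(2)[OF this] b[OF that] show ?thesis by linarith
  qed
  then have "(\<Sum>\<kappa>\<in>grid_indices D. Const (b \<kappa>) * bernstein_basis u D \<kappa>) \<in> P"
    unfolding bernstein_basis_def
    by (intro P_sum P_mult P_const P_prod P_power P_nat P_u) auto
  then show ?thesis using f by simp
qed

section \<open>Penalizing violated constraints\<close>

text \<open>
  The function \<open>t (1 - t / R) ^ n\<close> is a penalty: for even \<open>n \<rightarrow> \<infinity>\<close> it tends uniformly to 0 on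
  \<open>[0, R]\<close>, and to \<open>-\<infinity>\<close> uniformly on \<open>{..-\<delta>}\<close> if \<open>\<delta> > 0\<close>.  Both rates follow from
  Bernoulli's inequality.
\<close>

lemma penalty_upper:
  fixes t R :: real
  assumes "R > 0" and "t \<le> R" and "n > 0" and "even n"
  shows "(1 - t / R) ^ n * t \<le> R / n"
proof (cases "t \<ge> 0")
  case True
  define s where "s = t / R"
  have s: "0 \<le> s" "s \<le> 1" using assms True by (auto simp: s_def)
  have "(1 - s) ^ n * (1 + n * s) \<le> (1 - s) ^ n * (1 + s) ^ n"
    using s Bernoulli_inequality[of s n] by (intro mult_left_mono) auto
  also have "\<dots> = (1 - s ^ 2) ^ n"
    by (simp add: power2_eq_square algebra_simps flip: power_mult_distrib)
  also have "\<dots> \<le> 1" using s by (intro power_le_one) (auto simp: power_le_one)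
  finally have "(1 - s) ^ n + (1 - s) ^ n * (n * s) \<le> 1" by (simp add: distrib_left)
  moreover have "(1 - s) ^ n \<ge> 0" using s by simp
  ultimately have "(1 - s) ^ n * (n * s) \<le> 1" by linarith
  moreover have "t = R * s" using assms by (simp add: s_def)
  ultimately show ?thesis
    using assms by (simp add: field_simps flip: s_def)
next
  case False
  have "(1 - t / R) ^ n \<ge> 0" using assms(4) by (rule zero_le_even_power)
  then have "(1 - t / R) ^ n * t \<le> 0" using False by (simp add: mult_nonneg_nonpos)
  also have "0 \<le> R / n" using assms by simp
  finally show ?thesis .
qed

lemma penalty_lower:
  fixes t R \<delta> :: real
  assumes "R > 0" and "\<delta> \<ge> 0" and "t \<le> - \<delta>"
  shows "(1 - t / R) ^ n * t \<le> - (n * \<delta> / R * \<delta>)"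
proof -
  have "1 + n * (\<delta> / R) \<le> (1 + \<delta> / R) ^ n"
    using assms by (intro Bernoulli_inequality) (smt (verit) divide_nonneg_pos)
  also have "\<dots> \<le> (1 - t / R) ^ n"
    using assms divide_right_mono[of \<delta> "- t" R] by (intro power_mono) auto
  finally have *: "n * \<delta> / R \<le> (1 - t / R) ^ n" by simp
  have "n * \<delta> / R * \<delta> \<le> (1 - t / R) ^ n * (- t)"
    using * assms by (intro mult_mono) (auto intro: order_trans[OF _ *])
  then show ?thesis by simp
qed

text \<open>
  By compactness, \<open>p\<close> stays above some \<open>\<epsilon> > 0\<close> even where the constraints are violated by at
  most some \<open>\<delta> > 0\<close>; there the penalties must sum to less than \<open>\<epsilon>\<close>.  Elsewhere the penalty of
  one constraint violated by more than \<open>\<delta>\<close> must outweigh the bound \<open>Q\<close> on \<open>p\<close> and all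
  other penalties.  A large exponent achieves both.
\<close>

lemma positive_minus_penalties:
  fixes h :: "'i \<Rightarrow> 'a::topological_space \<Rightarrow> real"
  assumes K: "compact K" and I: "finite I"
    and cont: "continuous_on K p" "\<And>i. i \<in> I \<Longrightarrow> continuous_on K (h i)"
    and pos: "\<And>x. x \<in> K \<Longrightarrow> (\<And>i. i \<in> I \<Longrightarrow> h i x \<ge> 0) \<Longrightarrow> p x > 0"
  shows "\<exists>R>0. \<exists>N. \<forall>x\<in>K. (\<Sum>i\<in>I. ((1 - h i x / R) ^ N) ^ 2 * h i x) < p x"
proof (cases "K = {}")
  case True
  then show ?thesis by (auto intro: exI[of _ 1])
next
  case False
  have bounded: "\<exists>B. \<forall>x\<in>K. \<bar>f x\<bar> \<le> B" if "continuous_on K f" for f :: "'a \<Rightarrow> real"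
    using compact_imp_bounded[OF compact_continuous_image[OF that K]]
    by (auto simp: bounded_iff)
  have "\<forall>i\<in>I. \<exists>B. \<forall>x\<in>K. \<bar>h i x\<bar> \<le> B" using bounded cont(2) by blast
  then obtain B where "\<forall>i\<in>I. \<forall>x\<in>K. \<bar>h i x\<bar> \<le> B i" by (rule bchoice[THEN exE])
  then have B: "\<bar>h i x\<bar> \<le> B i" if "i \<in> I" "x \<in> K" for i x using that by blast
  obtain Q where Q: "\<And>x. x \<in> K \<Longrightarrow> \<bar>p x\<bar> \<le> Q"
    using bounded[OF cont(1)] by blast
  define R where "R = 1 + (\<Sum>i\<in>I. \<bar>B i\<bar>)"
  have R: "R > 0" by (simp add: R_def add_pos_nonneg sum_nonneg)
  have hR: "h i x \<le> R" if "i \<in> I" "x \<in> K" for i x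
    using B[OF that] member_le_sum[of i I "\<lambda>i. \<bar>B i\<bar>"] that I by (auto simp: R_def)
  \<comment> \<open>This continuous function vanishes only where \<open>p\<close> is not positive although no constraint
     is violated, hence nowhere on \<open>K\<close>.  Half of its minimum goes to \<open>\<epsilon>\<close>, the other half
     is split among the constraints.\<close>
  define \<phi> where "\<phi> x = max (p x) 0 + (\<Sum>i\<in>I. max (- h i x) 0)" for x
  have "continuous_on K \<phi>"
    unfolding \<phi>_def using cont by (intro continuous_intros) auto
  then obtain z where z: "z \<in> K" "\<And>x. x \<in> K \<Longrightarrow> \<phi> z \<le> \<phi> x"
    using continuous_attains_inf[OF K False] by blast
  have \<phi>_pos: "\<phi> z > 0"
  proof (cases "\<forall>i\<in>I. h i z \<ge> 0")
    case True
    then have "p z > 0" using pos z by blast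
    then show ?thesis unfolding \<phi>_def by (intro add_pos_nonneg sum_nonneg) auto
  next
    case False
    then obtain i where i: "i \<in> I" "h i z < 0" by fastforce
    then have "0 < (\<Sum>i\<in>I. max (- h i z) 0)"
      using I by (intro sum_pos2[of I i]) auto
    then show ?thesis by (simp add: \<phi>_def add_nonneg_pos)
  qed
  define c where "c = real (card I) + 1"
  define \<delta> where "\<delta> = \<phi> z / (2 * c)"
  define \<epsilon> where "\<epsilon> = \<phi> z / 2"
  have c: "c > 0" by (simp add: c_def add_nonneg_pos)
  have \<delta>: "\<delta> > 0" and \<epsilon>: "\<epsilon> > 0" using \<phi>_pos c by (simp_all add: \<delta>_def \<epsilon>_def)
  have margin: "p x \<ge> \<epsilon>" if "x \<in> K" "\<And>i. i \<in> I \<Longrightarrow> h i x \<ge> - \<delta>" for x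
  proof -
    have "max (- h i x) 0 \<le> \<delta>" if "i \<in> I" for i
      using \<open>\<And>i. i \<in> I \<Longrightarrow> h i x \<ge> - \<delta>\<close>[OF that] \<delta> by simp
    then have "(\<Sum>i\<in>I. max (- h i x) 0) \<le> (\<Sum>i\<in>I. \<delta>)" by (rule sum_mono)
    also have "\<dots> \<le> c * \<delta>" using \<delta> by (simp add: c_def distrib_right)
    also have "\<dots> = \<epsilon>" using c by (simp add: \<delta>_def \<epsilon>_def)
    finally have "\<phi> x \<le> max (p x) 0 + \<epsilon>" by (simp add: \<phi>_def)
    then have "2 * \<epsilon> \<le> max (p x) 0 + \<epsilon>" using z(2)[OF that(1)] by (simp add: \<epsilon>_def)
    then show ?thesis using \<epsilon> by linarith
  qed
  obtain N where N: "c * R / \<epsilon> + (Q + \<epsilon>) * R / \<delta> ^ 2 + 1 \<le> real N"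
    using real_arch_simple by blast
  have Q0: "Q \<ge> 0" using Q[OF z(1)] by linarith
  have nonneg: "c * R / \<epsilon> \<ge> 0" "(Q + \<epsilon>) * R / \<delta> ^ 2 \<ge> 0" using c R \<epsilon> \<delta> Q0 by simp_all
  define n where "n = 2 * N"
  have n: "even n" "n > 0" "c * R / \<epsilon> < n" "(Q + \<epsilon>) * R / \<delta> ^ 2 < n"
    using N nonneg by (auto simp: n_def intro: gr0I)
  have small: "c * (R / n) < \<epsilon>"
    using n \<epsilon> by (simp add: field_simps)
  have large: "Q + \<epsilon> < n * \<delta> / R * \<delta>"
    using n \<delta> R by (simp add: field_simps power2_eq_square)
  have square: "((1 - t / R) ^ N) ^ 2 = (1 - t / R) ^ n" for t
    by (simp add: n_def power_mult mult.commute flip: power_mult)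
  have upper: "(1 - h i x / R) ^ n * h i x \<le> R / n" if "i \<in> I" "x \<in> K" for i x
    using penalty_upper R hR that n by blast
  have bound: "(\<Sum>i\<in>J. (1 - h i x / R) ^ n * h i x) < \<epsilon>" if "J \<subseteq> I" "x \<in> K" for J x
  proof -
    have "(\<Sum>i\<in>J. (1 - h i x / R) ^ n * h i x) \<le> (\<Sum>i\<in>J. R / n)"
      using upper that by (intro sum_mono) auto
    also have "\<dots> = card J * (R / n)" by simp
    also have "\<dots> \<le> c * (R / n)"
      using card_mono[OF I that(1)] R by (intro mult_right_mono) (auto simp: c_def)
    finally show ?thesis using small by linarith
  qed
  have "(\<Sum>i\<in>I. ((1 - h i x / R) ^ N) ^ 2 * h i x) < p x" if x: "x \<in> K" for x
  proof (cases "\<forall>i\<in>I. h i x \<ge> - \<delta>")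
    case True
    then show ?thesis using margin[OF x] bound[OF subset_refl x] by (auto simp: square)
  next
    case False
    then obtain i where i: "i \<in> I" "h i x \<le> - \<delta>" by force
    have "(\<Sum>i\<in>I. (1 - h i x / R) ^ n * h i x)
        = (1 - h i x / R) ^ n * h i x + (\<Sum>j\<in>I - {i}. (1 - h j x / R) ^ n * h j x)"
      using I i by (simp add: sum.remove)
    also have "\<dots> < - (Q + \<epsilon>) + \<epsilon>"
      using penalty_lower[OF R less_imp_le[OF \<delta>] i(2), of n] large bound[of "I - {i}" x] x
      by (intro add_strict_mono) auto
    also have "\<dots> \<le> p x" using Q[OF x] by linarith
    finally show ?thesis by (simp add: square)
  qed
  then show ?thesis using R by blast
qed

section \<open>The representation\<close>

text \<open>
  This is the identity \<open>2 R (R \<plusminus> y) = (R \<plusminus> y)\<^sup>2 + (R\<^sup>2 - y\<^sup>2)\<close>, divided by \<open>4 R\<^sup>2\<close>.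
\<close>

lemma scaled_coordinate_mem_generated_preordering:
  fixes y b :: "'n::finite mpoly"
  assumes R: "R > 0" and y: "Const (R ^ 2) - y ^ 2 \<in> generated_preordering b"
  shows "Const (1 / (2 * R)) * (y + Const R) \<in> generated_preordering b"
    and "1 - Const (1 / (2 * R)) * (y + Const R) \<in> generated_preordering b"
proof -
  have scale: "Const (1 / (2 * R)) * (z + Const R) \<in> generated_preordering b"
    if z: "Const (R ^ 2) - z ^ 2 \<in> generated_preordering b" for z
  proof -
    have half: "Const (1 / (4 * R ^ 2)) * Const (2 * R) = Const (1 / (2 * R))"
      using R by (simp add: power2_eq_square flip: Const_mult)
    have double: "Const (2 * R) = Const R + Const R" by (simp flip: Const_add)
    have "(z + Const R) ^ 2 + (Const (R ^ 2) - z ^ 2) = Const (2 * R) * (z + Const R)"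
      unfolding Const_power double by (simp add: power2_eq_square algebra_simps)
    then have "Const (1 / (2 * R)) * (z + Const R)
        = Const (1 / (4 * R ^ 2)) * ((z + Const R) ^ 2 + (Const (R ^ 2) - z ^ 2))"
      by (simp add: half flip: mult.assoc)
    also have "\<dots> \<in> generated_preordering b"
      using z by (intro generated_preordering_mult generated_preordering_add)
        (auto intro!: generated_preordering_sos sos_Const sos_square)
    finally show ?thesis .
  qed
  show "Const (1 / (2 * R)) * (y + Const R) \<in> generated_preordering b"
    using scale[OF y] .
  have "1 - Const (1 / (2 * R)) * (y + Const R) = Const (1 / (2 * R)) * (- y + Const R)"
  proof -
    have "1 = Const (1 / (2 * R)) * Const (2 * R)" using R by (simp flip: Const_mult)
    also have "\<dots> = Const (1 / (2 * R)) * (Const R + Const R)" by (simp flip: Const_add)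
    finally show ?thesis by (simp add: algebra_simps)
  qed
  then show "1 - Const (1 / (2 * R)) * (y + Const R) \<in> generated_preordering b"
    using scale[of "- y"] y by simp
qed

theorem proposition5:
  fixes g :: "'m::finite \<Rightarrow> 'n::finite mpoly"
    and L :: "real ^ 'n" and M Mh :: real and p :: "'n mpoly"
  assumes "feasible_set g \<noteq> {}"
    and "compact (feasible_set g)"
    and "feasible_set g \<subseteq> {x. L \<le> x \<and> (\<Sum>i\<in>UNIV. x $ i) \<le> M}"
    and "Mh \<ge> M + (\<Sum>j\<in>UNIV. mnorm (g j) *
           (1 + M + (\<Sum>i\<in>UNIV. \<bar>L $ i\<bar> - L $ i)) ^ tdeg (g j))"
    and "\<And>x. x \<in> feasible_set g \<Longrightarrow> meval p x > 0"
  shows "\<exists>(\<sigma>0 :: 'n mpoly) (\<sigma>1 :: 'n mpoly) (\<rho> :: 'n + 'm + unit \<Rightarrow> real poly).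
           sos \<sigma>0 \<and> sos \<sigma>1 \<and> (\<forall>k. sos (\<rho> k)) \<and>
           p = \<sigma>0 + \<sigma>1 * (Const (Mh ^ 2) - (\<Sum>k\<in>UNIV. (ghat g L Mh k) ^ 2))
               + (\<Sum>k\<in>UNIV. subst_poly (\<rho> k) (ghat g L Mh k) * ghat g L Mh k)"
proof -
  define G where "G = ghat g L Mh"
  define b where "b = Const (Mh ^ 2) - (\<Sum>k\<in>UNIV. G k ^ 2)"
  \<comment> \<open>Adding 1 makes the box nondegenerate even if \<open>Mh = 0\<close>.\<close>
  define r where "r = \<bar>Mh\<bar> + 1"
  define l :: "real ^ 'n" where "l = (\<chi> i. L $ i - r)"
  define u where "u i = Const (1 / (2 * r)) * (Var i - Const (l $ i))" for i
  have r: "r > 0" by (simp add: r_def add_nonneg_pos)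
  have "Mh ^ 2 \<le> r ^ 2" by (subst abs_le_square_iff[symmetric]) (simp add: r_def)
  then have slack: "r ^ 2 - Mh ^ 2 \<ge> 0" by simp

  have coordinate: "u i \<in> generated_preordering b" "1 - u i \<in> generated_preordering b" for i
  proof -
    have "(\<Sum>k\<in>UNIV. G k ^ 2) = G (Inl i) ^ 2 + (\<Sum>k\<in>UNIV - {Inl i}. G k ^ 2)"
      by (simp add: sum.remove)
    then have "Const (r ^ 2) - G (Inl i) ^ 2
        = b + (\<Sum>k\<in>UNIV - {Inl i}. G k ^ 2) + Const (r ^ 2 - Mh ^ 2)"
      by (simp add: b_def Const_diff)
    also have "\<dots> \<in> generated_preordering b"
      using slack by (intro generated_preordering_add generated_preordering_generator)
        (auto intro!: generated_preordering_sos sos_sum sos_square sos_Const)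
    finally have "Const (r ^ 2) - G (Inl i) ^ 2 \<in> generated_preordering b" .
    moreover have "u i = Const (1 / (2 * r)) * (G (Inl i) + Const r)"
      by (simp add: u_def l_def G_def ghat_def Const_diff algebra_simps)
    ultimately show "u i \<in> generated_preordering b" "1 - u i \<in> generated_preordering b"
      using scaled_coordinate_mem_generated_preordering[OF r] by simp_all
  qed

  \<comment> \<open>The index \<open>None\<close> stands for the ball constraint, which is penalized like the others.\<close>
  define h where "h k = (case k of None \<Rightarrow> b | Some k \<Rightarrow> G k)" for k
  let ?K = "cbox l (\<chi> i. l $ i + 2 * r)"
  have feasible: "meval p x > 0" if "\<And>k. k \<in> UNIV \<Longrightarrow> meval (h k) x \<ge> 0" for x
  proof -
    have "meval (g j) x \<ge> 0" for j
      using that[of "Some (Inr (Inl j))"] by (simp add: h_def G_def ghat_def)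
    then show ?thesis using assms(5) by (simp add: feasible_set_def)
  qed
  have "\<exists>R>0. \<exists>N. \<forall>x\<in>?K.
      (\<Sum>k\<in>UNIV. ((1 - meval (h k) x / R) ^ N) ^ 2 * meval (h k) x) < meval p x"
    by (intro positive_minus_penalties compact_cbox finite continuous_on_meval) (rule feasible, blast)
  then obtain R N where pos: "\<And>x. x \<in> ?K \<Longrightarrow>
      (\<Sum>k\<in>UNIV. ((1 - meval (h k) x / R) ^ N) ^ 2 * meval (h k) x) < meval p x"
    by blast
  define q where "q k = (1 - Const (1 / R) * h k) ^ N" for k
  define f where "f = p - (\<Sum>k\<in>UNIV. q k ^ 2 * h k)"
  have "f \<in> generated_preordering b"
  proof (rule positive_on_box_imp_mem)
    show "2 * r > 0" using r by simp
    show "meval f x > 0" if "x \<in> ?K" for x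
      using pos[OF that] by (simp add: f_def q_def)
  qed (auto simp: u_def intro: generated_preordering_add generated_preordering_mult generated_preordering_sos sos_Const
      coordinate[unfolded u_def])
  then obtain \<sigma>0 \<sigma>1 where \<sigma>: "sos \<sigma>0" "sos \<sigma>1" "f = \<sigma>0 + \<sigma>1 * b"
    by (auto simp: generated_preordering_def)

  define \<rho> :: "real poly" where "\<rho> = ([:1, - (1 / R):] ^ N) ^ 2"
  have subst: "subst_poly \<rho> (G k) = q (Some k) ^ 2" for k
    by (simp add: \<rho>_def q_def h_def subst_linear_power Const_uminus flip: power_mult)
  have "p = f + (\<Sum>k\<in>UNIV. q k ^ 2 * h k)" by (simp add: f_def)
  also have "(\<Sum>k\<in>UNIV. q k ^ 2 * h k) = q None ^ 2 * b + (\<Sum>k\<in>UNIV. subst_poly \<rho> (G k) * G k)"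
    by (simp add: UNIV_option_conv sum.reindex subst) (simp add: h_def)
  finally have "p = \<sigma>0 + (\<sigma>1 + q None ^ 2) * b + (\<Sum>k\<in>UNIV. subst_poly \<rho> (G k) * G k)"
    by (simp add: \<sigma> distrib_right add.assoc)
  moreover have "sos (\<sigma>1 + q None ^ 2)" "sos \<rho>"
    unfolding \<rho>_def using \<sigma> by (simp_all add: sos_add sos_square)
  ultimately show ?thesis
    using \<sigma>(1) unfolding b_def G_def
    by (intro exI[of _ \<sigma>0] exI[of _ "\<sigma>1 + q None ^ 2"] exI[of _ "\<lambda>_. \<rho>"]) simp
qed

end
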